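(* Let $(X,\varphi)$ be an irreducible Smale space with metric $d$, let $(\mathcal R_n^\delta)_{n\ge0}$ be a refining sequence of $\delta$-enlarged Markov partitions of $X$, with enumerations $\mathcal R_n^\delta=\{R_{n,k}^\delta:1\le k\le\#\mathcal R_n^\delta\}$, and let $\mathcal F_n=\{F_{n,k}:1\le k\le\#\mathcal R_n^\delta\}$ be the associated partitions of unity $$F_{n,k}(x)=\frac{h_{n,k}(x)}{\sum_jh_{n,j}(x)},\qquad h_{n,k}(x)=d(x,X\setminus R_{n,k}^\delta)\ (n\ge1),\qquad h_{0,1}\equiv1 .$$ Then for every $n\ge0$ and $1\le k\le\#\mathcal R_n^\delta$ the Lipschitz constant of $F_{n,k}$ satisfies $$\mathrm{Lip}(F_{n,k})\le\frac{2(\#\mathcal R_1^\delta)^2+1}{\mathrm{Leb}(\mathcal R_n^\delta)} .$$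
   Context: A Smale space $(X,\varphi)$ consists of an infinite compact metric space $(X,d)$, a homeomorphism $\varphi:X\to X$, constants $\varepsilon_X>0$, $\lambda>1$ and a continuous bracket map $[\cdot,\cdot]:\{(x,y)\in X\times X: d(x,y)\le\varepsilon_X\}\to X$ with $[x,x]=x$, $[x,[y,z]]=[x,z]$, $[[x,y],z]=[x,z]$, $\varphi[x,y]=[\varphi(x),\varphi(y)]$ whenever both sides are defined, and such that, for $0<\varepsilon\le\varepsilon_X$ and $X^s(x,\varepsilon)=\{y:d(x,y)<\varepsilon,[y,x]=x\}$, $X^u(x,\varepsilon)=\{y:d(x,y)<\varepsilon,[x,y]=x\}$, one has $d(\varphi(y),\varphi(z))\le\lambda^{-1}d(y,z)$ for $y,z\in X^s(x,\varepsilon)$ and $d(\varphi^{-1}(y),\varphi^{-1}(z))\le\lambda^{-1}d(y,z)$ for $y,z\in X^u(x,\varepsilon)$. A constant $0<\varepsilon_X'\le\varepsilon_X/2$ is fixed such that $d(x,y)\le\varepsilon_X'$ implies $d(x,[x,y]),d(y,[x,y])<\varepsilon_X/2$. Irreducible: for all non-empty open $U,W\subset X$ there is $n\ge1$ with $\varphi^n(U)\cap W\ne\varnothing$. $\mathrm h(\varphi)$ is the topological entropy. A rectangle is a non-empty $R\subset X$ with $\mathrm{diam}(R)\le\varepsilon_X'$ and $[x,y]\in R$ for all $x,y\in R$. For a finite cover $\mathcal U$ of $X$ (with $\varnothing,X\notin\mathcal U$): $\mathrm{diam}(\mathcal U)$ is the largest diameter of a member; $\mathrm m(\mathcal U)$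 is the largest number of distinct members with non-empty common intersection; $\mathrm{Leb}(\mathcal U)=\min_{x\in X}\max_{U\in\mathcal U}d(x,X\setminus U)$. For $\mathcal R_0^\delta=\{X\}$ use the convention $d(x,\varnothing)=+\infty$, so that the bound for $n=0$ reads $\mathrm{Lip}(F_{0,1})=0$. A refining sequence of $\delta$-enlarged Markov partitions is a sequence of finite open covers $(\mathcal R_n^\delta)_{n\ge0}$ with $\mathcal R_0^\delta=\{X\}$ (obtained, by a known theorem, from $\delta$-enlarging a Markov partition of small diameter and its refinements) with the following properties for every $n\ge1$, where $C,c>0$ and $0<\theta\le\varepsilon_X$ are constants: (1) $\mathcal R_n^\delta$ consists of open rectangles and $\mathcal R_{n+1}^\delta$ refines $\mathcal R_n^\delta$; (2) if $x,y$ lie in a common member of $\mathcal R_n^\delta$ then $d(\varphi^r(x),\varphi^r(y))<\varepsilon_X'$ for $|r|\le n-1$; (3) for $|r|\le n-1$, $\varphi^r(\mathcal R_n^\delta)$ refines $\mathcal R_{n-|r|}^\delta$; (4) $\mathrm{diam}(\mathcal R_n^\delta)\le\lambda^{-n+1}\theta$; (5) $\mathrm m(\mathcal R_n^\delta)\le(\#\mathcal R_1^\delta)^2$; (6) for every $\varepsilon\in(0,1)$, $ce^{2(\mathrm h(\varphi)-\varepsilon)n}<\#\mathcal R_n^\delta<Ce^{2(\mathrm h(\varphi)+\varepsilon)n}$ for all large $n$; (7) if $\varphi,\varphi^{-1}$ are Lipschitz with $\Lambda=\max\{\mathrm{Lip}(\varphi),\mathrm{Lip}(\varphi^{-1})\}$,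 there is $\eta\in(0,\theta]$ with $\mathrm{Leb}(\mathcal R_n^\delta)\ge\Lambda^{-n+1}\eta$ for all $n\ge1$. *)

theory Defs
  imports "HOL-Analysis.Analysis"
begin

section \<open>Smale spaces\<close>

text \<open>
  The underlying space \<open>X\<close> is the whole of a type of class \<^class>\<open>metric_space\<close>. The bracket is a
  total function in HOL, but it is only meaningful, and only constrained, on pairs of points at
  distance at most \<open>\<epsilon>X\<close>.
\<close>

definition local_stable :: "('a::metric_space \<Rightarrow> 'a \<Rightarrow> 'a) \<Rightarrow> 'a \<Rightarrow> real \<Rightarrow> 'a set" where
  "local_stable br x e = {y. dist x y < e \<and> br y x = x}"

definition local_unstable :: "('a::metric_space \<Rightarrow> 'a \<Rightarrow> 'a) \<Rightarrow> 'a \<Rightarrow> real \<Rightarrow> 'a set" where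
  "local_unstable br x e = {y. dist x y < e \<and> br x y = x}"

locale smale_space =
  fixes \<phi> :: "'a::metric_space \<Rightarrow> 'a"
    and br :: "'a \<Rightarrow> 'a \<Rightarrow> 'a"
    and \<epsilon>X \<epsilon>X' lam :: real
  assumes infinite_space: "infinite (UNIV :: 'a set)"
    and compact_space: "compact (UNIV :: 'a set)"
    and homeo: "\<exists>\<psi>. homeomorphism UNIV UNIV \<phi> \<psi>"
    and eps_pos: "\<epsilon>X > 0"
    and lambda_gt_1: "lam > 1"
    and bracket_continuous: "continuous_on {p. dist (fst p) (snd p) \<le> \<epsilon>X} (\<lambda>p. br (fst p) (snd p))"
    and bracket_refl: "br x x = x"
    and bracket_right: "\<lbrakk>dist y z \<le> \<epsilon>X; dist x (br y z) \<le> \<epsilon>X; dist x z \<le> \<epsilon>X\<rbrakk>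
          \<Longrightarrow> br x (br y z) = br x z"
    and bracket_left: "\<lbrakk>dist x y \<le> \<epsilon>X; dist (br x y) z \<le> \<epsilon>X; dist x z \<le> \<epsilon>X\<rbrakk>
          \<Longrightarrow> br (br x y) z = br x z"
    and bracket_equivariant: "\<lbrakk>dist x y \<le> \<epsilon>X; dist (\<phi> x) (\<phi> y) \<le> \<epsilon>X\<rbrakk>
          \<Longrightarrow> \<phi> (br x y) = br (\<phi> x) (\<phi> y)"
    and stable_contraction:
      "\<lbrakk>0 < e; e \<le> \<epsilon>X; y \<in> local_stable br x e; z \<in> local_stable br x e\<rbrakk>
          \<Longrightarrow> dist (\<phi> y) (\<phi> z) \<le> inverse lam * dist y z"
    and unstable_contraction:
      "\<lbrakk>0 < e; e \<le> \<epsilon>X; y \<in> local_unstable br x e; z \<in> local_unstable br x e\<rbrakk>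
          \<Longrightarrow> dist (inv \<phi> y) (inv \<phi> z) \<le> inverse lam * dist y z"
    and eps'_pos: "\<epsilon>X' > 0"
    and eps'_le: "\<epsilon>X' \<le> \<epsilon>X / 2"
    and eps'_bracket: "dist x y \<le> \<epsilon>X' \<Longrightarrow> dist x (br x y) < \<epsilon>X / 2 \<and> dist y (br x y) < \<epsilon>X / 2"

definition irreducible_map :: "('a::topological_space \<Rightarrow> 'a) \<Rightarrow> bool" where
  "irreducible_map \<phi> \<longleftrightarrow>
     (\<forall>U W. open U \<and> U \<noteq> {} \<and> open W \<and> W \<noteq> {} \<longrightarrow> (\<exists>n\<ge>1. (\<phi> ^^ n) ` U \<inter> W \<noteq> {}))"

definition rectangle :: "('a::metric_space \<Rightarrow> 'a \<Rightarrow> 'a) \<Rightarrow> real \<Rightarrow> 'a set \<Rightarrow> bool" where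
  "rectangle br \<epsilon>X' R \<longleftrightarrow> R \<noteq> {} \<and> diameter R \<le> \<epsilon>X' \<and> (\<forall>x\<in>R. \<forall>y\<in>R. br x y \<in> R)"

definition int_iter :: "('a \<Rightarrow> 'a) \<Rightarrow> int \<Rightarrow> 'a \<Rightarrow> 'a" where
  "int_iter \<phi> r = (if r \<ge> 0 then \<phi> ^^ nat r else inv \<phi> ^^ nat (- r))"

section \<open>Topological entropy\<close>

definition bowen_separated :: "('a::metric_space \<Rightarrow> 'a) \<Rightarrow> nat \<Rightarrow> real \<Rightarrow> 'a set \<Rightarrow> bool" where
  "bowen_separated \<phi> n e E \<longleftrightarrow>
     (\<forall>x\<in>E. \<forall>y\<in>E. x \<noteq> y \<longrightarrow> (\<exists>i<n. dist ((\<phi> ^^ i) x) ((\<phi> ^^ i) y) > e))"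

text \<open>
  Bowen's definition through \<open>(n, e)\<close>-separated sets. The limit for \<open>e\<close> tending to \<open>0\<close> is a
  supremum, because the growth rate is antitone in \<open>e\<close>.
\<close>

definition topological_entropy :: "('a::metric_space \<Rightarrow> 'a) \<Rightarrow> ereal" where
  "topological_entropy \<phi> =
     (SUP e\<in>{0<..}. limsup (\<lambda>n.
        SUP E\<in>{E. finite E \<and> E \<noteq> {} \<and> bowen_separated \<phi> n e E}. ereal (ln (real (card E)) / real n)))"

section \<open>Lipschitz constants and covers\<close>

text \<open>The least Lipschitz constant; it is \<open>\<infinity>\<close> if the function is not Lipschitz.\<close>

definition Lip :: "('a::metric_space \<Rightarrow> 'b::metric_space) \<Rightarrow> ennreal" where
  "Lip f = (INF L\<in>{L. L-lipschitz_on UNIV f}. ennreal L)"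

text \<open>
  Unlike \<^const>\<open>infdist\<close>, which is \<open>0\<close> for the empty set, this distance satisfies
  \<open>d(x, \<emptyset>) = \<infinity>\<close>.
\<close>

definition edist_set :: "'a::metric_space \<Rightarrow> 'a set \<Rightarrow> ennreal" where
  "edist_set x A = (INF y\<in>A. ennreal (dist x y))"

definition Leb :: "'a::metric_space set set \<Rightarrow> ennreal" where
  "Leb \<U> = (INF x. SUP U\<in>\<U>. edist_set x (- U))"

definition cover_diam :: "'a::metric_space set set \<Rightarrow> real" where
  "cover_diam \<U> = Max (diameter ` \<U>)"

definition cover_mult :: "'a set set \<Rightarrow> nat" where
  "cover_mult \<U> = Max {card \<V> |\<V>. \<V> \<subseteq> \<U> \<and> \<Inter>\<V> \<noteq> {}}"

definition refines :: "'a set set \<Rightarrow> 'a set set \<Rightarrow> bool" where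
  "refines \<V> \<U> \<longleftrightarrow> (\<forall>V\<in>\<V>. \<exists>U\<in>\<U>. V \<subseteq> U)"

section \<open>Refining sequences\<close>

text \<open>
  In the cardinality estimate the entropy is converted to a real number; this loses nothing, since
  the homeomorphism of a Smale space is expansive and hence has finite entropy.
\<close>

definition refining_sequence ::
  "('a::metric_space \<Rightarrow> 'a) \<Rightarrow> ('a \<Rightarrow> 'a \<Rightarrow> 'a) \<Rightarrow> real \<Rightarrow> real \<Rightarrow> real \<Rightarrow> (nat \<Rightarrow> 'a set set) \<Rightarrow> bool"
where
  "refining_sequence \<phi> br \<epsilon>X \<epsilon>X' lam \<R> \<longleftrightarrow>
     \<R> 0 = {UNIV} \<and>
     (\<forall>n\<ge>1. finite (\<R> n) \<and> \<Union>(\<R> n) = UNIV \<and> {} \<notin> \<R> n \<and> UNIV \<notin> \<R> n) \<and>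
     (\<forall>n\<ge>1. (\<forall>U\<in>\<R> n. open U \<and> rectangle br \<epsilon>X' U) \<and> refines (\<R> (Suc n)) (\<R> n)) \<and>
     (\<forall>n\<ge>1. \<forall>U\<in>\<R> n. \<forall>x\<in>U. \<forall>y\<in>U. \<forall>r::int. \<bar>r\<bar> \<le> int n - 1 \<longrightarrow>
        dist (int_iter \<phi> r x) (int_iter \<phi> r y) < \<epsilon>X') \<and>
     (\<forall>n\<ge>1. \<forall>r::int. \<bar>r\<bar> \<le> int n - 1 \<longrightarrow>
        refines ((\<lambda>U. int_iter \<phi> r ` U) ` \<R> n) (\<R> (n - nat \<bar>r\<bar>))) \<and>
     (\<forall>n\<ge>1. cover_mult (\<R> n) \<le> (card (\<R> 1))\<^sup>2) \<and>
     (\<exists>C c. C > 0 \<and> c > 0 \<and>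
        (\<forall>\<epsilon>::real. 0 < \<epsilon> \<and> \<epsilon> < 1 \<longrightarrow>
          (\<forall>\<^sub>F n in sequentially.
             c * exp (2 * (real_of_ereal (topological_entropy \<phi>) - \<epsilon>) * real n) < real (card (\<R> n)) \<and>
             real (card (\<R> n)) < C * exp (2 * (real_of_ereal (topological_entropy \<phi>) + \<epsilon>) * real n)))) \<and>
     (\<exists>\<theta>. 0 < \<theta> \<and> \<theta> \<le> \<epsilon>X \<and>
        (\<forall>n\<ge>1. cover_diam (\<R> n) \<le> lam powi (1 - int n) * \<theta>) \<and>
        (Lip \<phi> < \<infinity> \<and> Lip (inv \<phi>) < \<infinity> \<longrightarrow>
          (\<exists>\<eta>. 0 < \<eta> \<and> \<eta> \<le> \<theta> \<and>
             (\<forall>n\<ge>1. ennreal (enn2real (max (Lip \<phi>) (Lip (inv \<phi>))) powi (1 - int n) * \<eta>) \<le> Leb (\<R> n)))))"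

section \<open>The associated partitions of unity\<close>

text \<open>
  An enumeration of \<open>\<R> n\<close> is a function \<open>R n\<close> on \<open>{1..card (\<R> n)}\<close>. For \<open>n \<ge> 1\<close> no member is the
  whole space, so that \<^const>\<open>infdist\<close> is applied to a non-empty complement.
\<close>

definition bump :: "(nat \<Rightarrow> nat \<Rightarrow> 'a::metric_space set) \<Rightarrow> nat \<Rightarrow> nat \<Rightarrow> 'a \<Rightarrow> real" where
  "bump R n k x = (if n = 0 then 1 else infdist x (- R n k))"

definition partition_fun ::
  "(nat \<Rightarrow> 'a::metric_space set set) \<Rightarrow> (nat \<Rightarrow> nat \<Rightarrow> 'a set) \<Rightarrow> nat \<Rightarrow> nat \<Rightarrow> 'a \<Rightarrow> real" where
  "partition_fun \<R> R n k x = bump R n k x / (\<Sum>j = 1..card (\<R> n). bump R n j x)"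

end

theory Submission
  imports Defs
begin

text \<open>
  Write \<open>H\<close> for the sum of the bumps \<open>h\<^sub>j\<close>, which is at least the Lebesgue number. Since
  \<open>0 \<le> h\<^sub>k \<le> H\<close>, splitting
  \<open>F\<^sub>k x - F\<^sub>k y = (h\<^sub>k x - h\<^sub>k y) / H x + F\<^sub>k y * (H y - H x) / H x\<close> bounds the oscillation of
  \<open>F\<^sub>k\<close> by those of \<open>h\<^sub>k\<close> and \<open>H\<close>. Each bump is 1-Lipschitz, and only the bumps alive at \<open>x\<close> or
  at \<open>y\<close> contribute to \<open>H x - H y\<close>: at most twice the multiplicity of the cover.
\<close>

lemma lipschitz_normalized_bump:
  fixes h :: "'i \<Rightarrow> 'a::metric_space \<Rightarrow> real"
  assumes fin: "finite J" and k: "k \<in> J" and l: "l > 0"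
    and nonneg: "\<And>j x. j \<in> J \<Longrightarrow> h j x \<ge> 0"
    and lip: "\<And>j x y. j \<in> J \<Longrightarrow> \<bar>h j x - h j y\<bar> \<le> dist x y"
    and supp: "\<And>x. card {j\<in>J. h j x \<noteq> 0} \<le> M"
    and low: "\<And>x. l \<le> (\<Sum>j\<in>J. h j x)"
  shows "((2 * real M + 1) / l)-lipschitz_on UNIV (\<lambda>x. h k x / (\<Sum>j\<in>J. h j x))"
proof (rule lipschitz_onI)
  fix x y
  define H where "H z = (\<Sum>j\<in>J. h j z)" for z
  have Hl: "l \<le> H z" and Hpos: "H z > 0" for z
    using low[of z] l by (auto simp: H_def)
  have hH: "h k z \<le> H z" for z
    unfolding H_def using fin k nonneg by (intro member_le_sum) auto
  let ?S = "\<lambda>z. {j\<in>J. h j z \<noteq> 0}"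
  have "H x - H y = (\<Sum>j\<in>J. h j x - h j y)"
    by (simp add: H_def sum_subtractf)
  also have "\<dots> = (\<Sum>j\<in>?S x \<union> ?S y. h j x - h j y)"
    using fin by (intro sum.mono_neutral_right) auto
  finally have "\<bar>H x - H y\<bar> \<le> (\<Sum>j\<in>?S x \<union> ?S y. \<bar>h j x - h j y\<bar>)"
    by simp
  also have "\<dots> \<le> (\<Sum>j\<in>?S x \<union> ?S y. dist x y)"
    by (intro sum_mono) (use lip in auto)
  also have "\<dots> = real (card (?S x \<union> ?S y)) * dist x y"
    by simp
  also have "\<dots> \<le> real (2 * M) * dist x y"
    using card_Un_le[of "?S x" "?S y"] supp[of x] supp[of y]
    by (intro mult_right_mono) auto
  finally have Hdiff: "\<bar>H x - H y\<bar> \<le> 2 * real M * dist x y"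
    by simp
  \<comment> \<open>As this quotient enters only as a factor in [0,1], the sole remaining division
    is by \<open>H x\<close>; the constant therefore carries \<open>1 / l\<close> and not
    \<open>1 / l^2\<close>.\<close>
  have F: "0 \<le> h k y / H y" "h k y / H y \<le> 1"
    using nonneg[OF k, of y] hH[of y] Hpos[of y] by auto
  have "h k x / H x - h k y / H y = ((h k x - h k y) + h k y / H y * (H y - H x)) / H x"
    using Hpos[of x] Hpos[of y] by (simp add: field_simps)
  also have "\<bar>\<dots>\<bar> \<le> (dist x y + 2 * real M * dist x y) / H x"
  proof -
    have "\<bar>h k y / H y * (H y - H x)\<bar> \<le> 1 * \<bar>H x - H y\<bar>"
      unfolding abs_mult using F by (intro mult_mono) auto
    then have "\<bar>h k y / H y * (H y - H x)\<bar> \<le> 2 * real M * dist x y"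
      using Hdiff by (simp only: mult_1)
    with lip[OF k, of x y]
    have "\<bar>(h k x - h k y) + h k y / H y * (H y - H x)\<bar> \<le> dist x y + 2 * real M * dist x y"
      by (intro order_trans[OF abs_triangle_ineq] add_mono)
    then show ?thesis
      using Hpos[of x] by (simp add: divide_right_mono)
  qed
  also have "\<dots> \<le> (dist x y + 2 * real M * dist x y) / l"
    using Hl l Hpos by (intro divide_left_mono) auto
  also have "\<dots> = (2 * real M + 1) / l * dist x y"
    by (simp add: field_simps)
  finally show "dist (h k x / (\<Sum>j\<in>J. h j x)) (h k y / (\<Sum>j\<in>J. h j y)) \<le> (2 * real M + 1) / l * dist x y"
    by (simp add: dist_real_def H_def)
qed (use l in simp)

text \<open>Both sides are the infimum of the same distances. A point of \<open>A\<close> makes the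
  extended infimum finite, hence a real lower bound of these distances, and keeps
  \<open>infdist\<close> away from its default value 0 for the empty set.\<close>

lemma edist_set_le_infdist:
  assumes "A \<noteq> {}"
  shows "edist_set x A \<le> ennreal (infdist x A)"
proof -
  obtain a where "a \<in> A"
    using assms by blast
  then have "edist_set x A \<le> ennreal (dist x a)"
    unfolding edist_set_def by (rule INF_lower)
  then have "edist_set x A < top"
    by (rule order.strict_trans1) simp
  then obtain r where r: "r \<ge> 0" "edist_set x A = ennreal r"
    by (cases "edist_set x A") auto
  have "r \<le> dist x b" if "b \<in> A" for b
  proof -
    have "ennreal r \<le> ennreal (dist x b)"
      unfolding r(2)[symmetric] edist_set_def using that by (rule INF_lower)
    then show ?thesis
      by simp
  qed
  then have "r \<le> infdist x A"
    using assms by (simp add: infdist_def cINF_greatest)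
  then show ?thesis
    by (simp add: r(2) ennreal_leI)
qed

text \<open>A supremum of nonnegative terms is at most their sum. This bounds the denominator of the
  partition functions from below. Since no member is the whole space, the two conventions for the
  distance to the empty set (\<infinity> and 0) never clash.\<close>

lemma Leb_le_sum_infdist:
  assumes "finite \<U>" "UNIV \<notin> \<U>"
  shows "Leb \<U> \<le> ennreal (\<Sum>U\<in>\<U>. infdist x (- U))"
proof -
  have "Leb \<U> \<le> (SUP U\<in>\<U>. edist_set x (- U))"
    unfolding Leb_def by (rule INF_lower) simp
  also have "\<dots> \<le> ennreal (\<Sum>U\<in>\<U>. infdist x (- U))"
  proof (rule SUP_least)
    fix U assume U: "U \<in> \<U>"
    then have "edist_set x (- U) \<le> ennreal (infdist x (- U))"
      using assms(2) by (intro edist_set_le_infdist) (metis Compl_empty_eq double_complement)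
    also have "\<dots> \<le> ennreal (\<Sum>U\<in>\<U>. infdist x (- U))"
      using assms(1) U infdist_nonneg by (intro ennreal_leI member_le_sum) auto
    finally show "edist_set x (- U) \<le> ennreal (\<Sum>U\<in>\<U>. infdist x (- U))" .
  qed
  finally show ?thesis .
qed

text \<open>The members containing \<open>x\<close> share the point \<open>x\<close>, so they form
  one of the families over which the maximum is taken; finiteness of the cover makes that maximum
  meaningful.\<close>

lemma card_containing_le_cover_mult:
  assumes "finite \<U>"
  shows "card {U\<in>\<U>. x \<in> U} \<le> cover_mult \<U>"
  unfolding cover_mult_def
proof (rule Max_ge)
  have "{card \<V> |\<V>. \<V> \<subseteq> \<U> \<and> \<Inter>\<V> \<noteq> {}} \<subseteq> card ` Pow \<U>"
    by auto
  then show "finite {card \<V> |\<V>. \<V> \<subseteq> \<U> \<and> \<Inter>\<V> \<noteq> {}}"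
    using assms by (meson finite_Pow_iff finite_imageI finite_subset)
  show "card {U\<in>\<U>. x \<in> U} \<in> {card \<V> |\<V>. \<V> \<subseteq> \<U> \<and> \<Inter>\<V> \<noteq> {}}"
    by blast
qed

lemma Lip_le:
  assumes "L-lipschitz_on UNIV f"
  shows "Lip f \<le> ennreal L"
  unfolding Lip_def using assms by (intro INF_lower) simp

lemma Lip_normalized_infdist:
  fixes \<U> :: "'a::metric_space set set"
  assumes fin: "finite \<U>" and proper: "UNIV \<notin> \<U>" and V: "V \<in> \<U>"
    and mult: "cover_mult \<U> \<le> M"
  shows "Lip (\<lambda>x. infdist x (- V) / (\<Sum>U\<in>\<U>. infdist x (- U))) \<le> (2 * of_nat M + 1) / Leb \<U>"
proof (cases "Leb \<U> = 0")
  case True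
  \<comment> \<open>In \<open>ennreal\<close> a nonzero numerator over 0 gives \<infinity>, so the
    bound is trivial.\<close>
  have "(2 * of_nat M + 1 :: ennreal) \<noteq> 0"
    by simp
  then show ?thesis
    by (simp add: True ennreal_divide_zero)
next
  case False
  have le: "Leb \<U> \<le> ennreal (\<Sum>U\<in>\<U>. infdist x (- U))" for x
    using fin proper by (rule Leb_le_sum_infdist)
  \<comment> \<open>The real-valued sum at any single point shows that the Lebesgue number is
    finite.\<close>
  have "Leb \<U> < top"
    by (rule order.strict_trans1[OF le[of undefined]]) simp
  with False obtain l where l: "l > 0" "Leb \<U> = ennreal l"
    by (cases "Leb \<U>") (auto simp: order_le_less)
  have "((2 * real M + 1) / l)-lipschitz_on UNIV
      (\<lambda>x. infdist x (- V) / (\<Sum>U\<in>\<U>. infdist x (- U)))"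
  proof (rule lipschitz_normalized_bump[OF fin V l(1), where h = "\<lambda>U x. infdist x (- U)"])
    show "\<bar>infdist x (- U) - infdist y (- U)\<bar> \<le> dist x y" for U and x y :: 'a
      by (rule infdist_triangle_abs)
    show "l \<le> (\<Sum>U\<in>\<U>. infdist x (- U))" for x
      using le[of x] by (simp add: l(2) sum_nonneg infdist_nonneg)
    fix x :: 'a
    \<comment> \<open>A bump vanishes off its own set, so the bumps alive at \<open>x\<close> are
      counted by the members containing \<open>x\<close>.\<close>
    have "infdist x (- U) = 0" if "x \<notin> U" for U
      using that by (intro infdist_zero) simp
    then have "{U\<in>\<U>. infdist x (- U) \<noteq> 0} \<subseteq> {U\<in>\<U>. x \<in> U}"
      by blast
    with fin have "card {U\<in>\<U>. infdist x (- U) \<noteq> 0} \<le> card {U\<in>\<U>. x \<in> U}"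
      by (intro card_mono) simp_all
    also have "\<dots> \<le> M"
      using card_containing_le_cover_mult[OF fin] mult by (rule order_trans)
    finally show "card {U\<in>\<U>. infdist x (- U) \<noteq> 0} \<le> M" .
  qed (rule infdist_nonneg)
  then have "Lip (\<lambda>x. infdist x (- V) / (\<Sum>U\<in>\<U>. infdist x (- U))) \<le> ennreal ((2 * real M + 1) / l)"
    by (rule Lip_le)
  also have "\<dots> = ennreal (2 * real M + 1) / ennreal l"
    using l(1) by (intro divide_ennreal[symmetric]) auto
  also have "ennreal (2 * real M + 1) = 2 * of_nat M + 1"
    by (simp add: ennreal_plus ennreal_mult ennreal_of_nat_eq_real_of_nat)
  finally show ?thesis
    by (simp add: l(2))
qed

theorem proposition4p1:
  fixes \<phi> :: "'a::metric_space \<Rightarrow> 'a"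
    and br :: "'a \<Rightarrow> 'a \<Rightarrow> 'a"
    and \<epsilon>X \<epsilon>X' lam :: real
    and \<R> :: "nat \<Rightarrow> 'a set set"
    and R :: "nat \<Rightarrow> nat \<Rightarrow> 'a set"
    and n k :: nat
  assumes "smale_space \<phi> br \<epsilon>X \<epsilon>X' lam"
    and "irreducible_map \<phi>"
    and "refining_sequence \<phi> br \<epsilon>X \<epsilon>X' lam \<R>"
    and "\<And>m. bij_betw (R m) {1..card (\<R> m)} (\<R> m)"
    and "1 \<le> k" and "k \<le> card (\<R> n)"
  shows "Lip (partition_fun \<R> R n k) \<le> (2 * of_nat (card (\<R> 1)) ^ 2 + 1) / Leb (\<R> n)"
proof (cases "n = 0")
  case True
  \<comment> \<open>All bumps of level 0 are the constant 1, so the quotient is constant; a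
    Lipschitz constant 0 lies below any bound.\<close>
  have "0-lipschitz_on UNIV (partition_fun \<R> R n k)"
    by (rule lipschitz_onI) (simp_all add: partition_fun_def bump_def True)
  then show ?thesis
    using Lip_le[of 0 "partition_fun \<R> R n k"] by simp
next
  case False
  have "\<forall>n\<ge>1. finite (\<R> n) \<and> \<Union>(\<R> n) = UNIV \<and> {} \<notin> \<R> n \<and> UNIV \<notin> \<R> n"
    using assms(3) unfolding refining_sequence_def by (elim conjE) assumption
  with False have fin: "finite (\<R> n)" and proper: "UNIV \<notin> \<R> n"
    by simp_all
  have "\<forall>n\<ge>1. cover_mult (\<R> n) \<le> (card (\<R> 1))\<^sup>2"
    using assms(3) unfolding refining_sequence_def by (elim conjE) assumption
  with False have mult: "cover_mult (\<R> n) \<le> (card (\<R> 1))\<^sup>2"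
    by simp
  have "R n k \<in> \<R> n"
    using assms(4)[of n] assms(5,6) by (auto simp: bij_betw_def)
  \<comment> \<open>The enumeration hits each member exactly once, which allows passing from
    numbered bumps to a sum over the cover itself.\<close>
  moreover have "(\<Sum>j = 1..card (\<R> n). infdist x (- R n j)) = (\<Sum>U\<in>\<R> n. infdist x (- U))" for x
    using assms(4)[of n] by (rule sum.reindex_bij_betw)
  then have "partition_fun \<R> R n k =
      (\<lambda>x. infdist x (- R n k) / (\<Sum>U\<in>\<R> n. infdist x (- U)))"
    using False by (simp add: fun_eq_iff partition_fun_def bump_def)
  ultimately show ?thesis
    using Lip_normalized_infdist[OF fin proper _ mult] by simp
qed

end
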